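(* Consider the signature $\Sigma_U=\{0,-,\mathrm{app},+,\cdot\}$ where $0$ is a constant, $-$ is unary minus, $\mathrm{app}$ is a unary function symbol (unary append, written postfix as $x1$ in the paper, semantically $x+1$), and $+,\cdot$ are binary. Let $N_1$ be the term rewriting system over $\Sigma_U\setminus\{-\}$ given by the left-to-right oriented equations [U1] $x+0=x$; [U2] $x+\mathrm{app}(y)=\mathrm{app}(x)+y$; [U3] $x\cdot 0=0$; [U4] $x\cdot\mathrm{app}(y)=x+(x\cdot y)$, and let $Z_1$ be the term rewriting system over $\Sigma_U$ consisting of [U1]--[U4] together with [U5] $-0=0$; [U6] $\mathrm{app}(-\mathrm{app}(x))=-x$; [U7] $-(-x)=x$; [U8] $x+(-y)=-((-x)+y)$; [U9] $x\cdot(-y)=-(x\cdot y)$. Then $N_1$ and $Z_1$ are ground-complete.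
   Context: Equations are read as rewrite rules from left to right with variables $x,y$. A term rewriting system is ground-complete if it is strongly terminating (no infinite rewrite sequences) and ground-confluent (confluent on closed terms). *)

theory Defs
  imports Main "HOL-Library.Confluence"
begin

datatype ('f, vars: 'v) trm = Var 'v | Fun 'f "('f, 'v) trm list"

type_synonym 'f signature = "('f \<times> nat) set"

datatype ('f, 'v) trs =
  TRS (sig: "'f signature") (rules: "(('f, 'v) trm \<times> ('f, 'v) trm) set")

inductive_set terms_over :: "'f signature \<Rightarrow> ('f, 'v) trm set" for F :: "'f signature" where
  "Var x \<in> terms_over F"
| "\<lbrakk>(f, length ts) \<in> F; \<And>t. t \<in> set ts \<Longrightarrow> t \<in> terms_over F\<rbrakk> \<Longrightarrow> Fun f ts \<in> terms_over F"

lemma Var_terms_over [simp]: "Var x \<in> terms_over F"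
  by (rule terms_over.intros)

lemma Fun_terms_over_iff [simp]:
  "Fun f ts \<in> terms_over F \<longleftrightarrow> (f, length ts) \<in> F \<and> set ts \<subseteq> terms_over F"
  by (auto intro: terms_over.intros elim: terms_over.cases)

definition closed_terms :: "'f signature \<Rightarrow> ('f, 'v) trm set" where
  "closed_terms F = {t \<in> terms_over F. vars t = {}}"

primrec subst_trm :: "('v \<Rightarrow> ('f, 'v) trm) \<Rightarrow> ('f, 'v) trm \<Rightarrow> ('f, 'v) trm" where
  "subst_trm \<sigma> (Var x) = \<sigma> x"
| "subst_trm \<sigma> (Fun f ts) = Fun f (map (subst_trm \<sigma>) ts)"

inductive step_rules ::
  "(('f, 'v) trm \<times> ('f, 'v) trm) set \<Rightarrow> ('f, 'v) trm \<Rightarrow> ('f, 'v) trm \<Rightarrow> bool"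
  for R :: "(('f, 'v) trm \<times> ('f, 'v) trm) set" where
  root: "(l, r) \<in> R \<Longrightarrow> step_rules R (subst_trm \<sigma> l) (subst_trm \<sigma> r)"
| arg: "step_rules R s t \<Longrightarrow> step_rules R (Fun f (ss @ s # ts)) (Fun f (ss @ t # ts))"

text \<open>The type \<open>trm\<close> also contains ill-formed terms (wrong arity, or symbols outside the
  signature), so the rewrite relation of a system is restricted to terms over its signature.\<close>

definition rewrite_step :: "('f, 'v) trs \<Rightarrow> ('f, 'v) trm \<Rightarrow> ('f, 'v) trm \<Rightarrow> bool" where
  "rewrite_step T s t \<longleftrightarrow>
     s \<in> terms_over (sig T) \<and> t \<in> terms_over (sig T) \<and> step_rules (rules T) s t"

definition strongly_terminating :: "('f, 'v) trs \<Rightarrow> bool" where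
  "strongly_terminating T \<longleftrightarrow> \<not> (\<exists>s :: nat \<Rightarrow> ('f, 'v) trm. \<forall>i. rewrite_step T (s i) (s (Suc i)))"

text \<open>When every rule satisfies \<open>vars r \<subseteq> vars l\<close>, as holds below, closed terms
  rewrite only to closed terms, so restricting both sides is confluence on closed terms.\<close>

definition ground_confluent :: "('f, 'v) trs \<Rightarrow> bool" where
  "ground_confluent T \<longleftrightarrow>
     confluentp (\<lambda>s t. s \<in> closed_terms (sig T) \<and> t \<in> closed_terms (sig T) \<and> rewrite_step T s t)"

definition ground_complete :: "('f, 'v) trs \<Rightarrow> bool" where
  "ground_complete T \<longleftrightarrow> strongly_terminating T \<and> ground_confluent T"

datatype symbol = Zero_sym | Minus_sym | App_sym | Plus_sym | Times_sym

definition Sigma_U :: "symbol signature" where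
  "Sigma_U = {(Zero_sym, 0), (Minus_sym, 1), (App_sym, 1), (Plus_sym, 2), (Times_sym, 2)}"

text \<open>The terms have countably many variables; the rules use two of them, \<open>x\<close> and \<open>y\<close>.\<close>

type_synonym uterm = "(symbol, nat) trm"

abbreviation x_var :: uterm where "x_var \<equiv> Var 0"
abbreviation y_var :: uterm where "y_var \<equiv> Var 1"
abbreviation zero_trm :: uterm ("\<zero>") where "\<zero> \<equiv> Fun Zero_sym []"
abbreviation minus_trm :: "uterm \<Rightarrow> uterm" ("\<ominus> _" [81] 80) where "\<ominus> s \<equiv> Fun Minus_sym [s]"
abbreviation app :: "uterm \<Rightarrow> uterm" where "app s \<equiv> Fun App_sym [s]"
abbreviation plus_trm :: "uterm \<Rightarrow> uterm \<Rightarrow> uterm" (infixl "\<oplus>" 65) where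
  "s \<oplus> t \<equiv> Fun Plus_sym [s, t]"
abbreviation times_trm :: "uterm \<Rightarrow> uterm \<Rightarrow> uterm" (infixl "\<odot>" 70) where
  "s \<odot> t \<equiv> Fun Times_sym [s, t]"

definition N1 :: "(symbol, nat) trs" where
  "N1 = TRS (Sigma_U - {(Minus_sym, 1)})
    {(x_var \<oplus> \<zero>, x_var),
     (x_var \<oplus> app y_var, app x_var \<oplus> y_var),
     (x_var \<odot> \<zero>, \<zero>),
     (x_var \<odot> app y_var, x_var \<oplus> (x_var \<odot> y_var))}"

definition Z1 :: "(symbol, nat) trs" where
  "Z1 = TRS Sigma_U
    (rules N1 \<union>
    {(\<ominus> \<zero>, \<zero>),
     (app (\<ominus> (app x_var)), \<ominus> x_var),
     (\<ominus> (\<ominus> x_var), x_var),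
     (x_var \<oplus> (\<ominus> y_var), \<ominus> ((\<ominus> x_var) \<oplus> y_var)),
     (x_var \<odot> (\<ominus> y_var), \<ominus> (x_var \<odot> y_var))})"

lemma rules_N1: "(l, r) \<in> rules N1 \<Longrightarrow>
    l \<in> terms_over (sig N1) \<and> r \<in> terms_over (sig N1) \<and> vars r \<subseteq> vars l"
  unfolding N1_def Sigma_U_def by (simp, elim disjE conjE; simp)

lemma rules_Z1: "(l, r) \<in> rules Z1 \<Longrightarrow>
    l \<in> terms_over (sig Z1) \<and> r \<in> terms_over (sig Z1) \<and> vars r \<subseteq> vars l"
  unfolding Z1_def N1_def Sigma_U_def by (simp, elim disjE conjE; simp)

end

theory Submission
  imports Defs
begin

text \<open>Termination: with \<open>0\<close>, \<open>-x\<close>, \<open>app(x)\<close>, \<open>x + y\<close>, \<open>x \<cdot> y\<close> interpreted over the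
  natural numbers as \<open>1\<close>, \<open>x + 1\<close>, \<open>x + 1\<close>, \<open>x + 3y\<close>, \<open>(x + 1) 4\<^sup>y\<close>, every rule decreases and
  every operation is strictly monotone. Ground confluence: rewriting preserves the value in the
  integers, a closed term that is not of the form \<open>app\<^sup>n(0)\<close> or \<open>-app\<^sup>n\<^sup>+\<^sup>1(0)\<close> can be rewritten,
  and distinct terms of this form have distinct values.\<close>

section \<open>Interpretations of terms and the rewrite relation\<close>

primrec eval_trm :: "('f \<Rightarrow> 'a list \<Rightarrow> 'a) \<Rightarrow> ('v \<Rightarrow> 'a) \<Rightarrow> ('f, 'v) trm \<Rightarrow> 'a" where
  "eval_trm I \<alpha> (Var x) = \<alpha> x"
| "eval_trm I \<alpha> (Fun f ts) = I f (map (eval_trm I \<alpha>) ts)"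

lemma eval_subst_trm:
  "eval_trm I \<alpha> (subst_trm \<sigma> t) = eval_trm I (\<lambda>x. eval_trm I \<alpha> (\<sigma> x)) t"
  by (induction t) (auto simp: comp_def intro!: arg_cong[of _ _ "I _"])

text \<open>A rule instance has the value of the rule itself under the assignment that evaluates the
  substitution, so it suffices to check the rules under all assignments.\<close>

lemma step_rules_eval_eq:
  assumes "step_rules R s t"
    and "\<And>l r \<alpha>. (l, r) \<in> R \<Longrightarrow> eval_trm I \<alpha> l = eval_trm I \<alpha> r"
  shows "eval_trm I \<alpha> s = eval_trm I \<alpha> t"
  using assms by (induction rule: step_rules.induct) (simp_all add: eval_subst_trm)

lemma step_rules_eval_less:
  fixes I :: "'f \<Rightarrow> 'a::order list \<Rightarrow> 'a"
  assumes "step_rules R s t"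
    and "\<And>l r \<alpha>. (l, r) \<in> R \<Longrightarrow> eval_trm I \<alpha> r < eval_trm I \<alpha> l"
    and "\<And>f as a b bs. a < b \<Longrightarrow> I f (as @ a # bs) < I f (as @ b # bs)"
  shows "eval_trm I \<alpha> t < eval_trm I \<alpha> s"
  using assms by (induction rule: step_rules.induct) (simp_all add: eval_subst_trm)

text \<open>Lets an interpretation checked once on a large set of rules serve every subset of
  it.\<close>

lemma step_rules_mono: "step_rules R s t \<Longrightarrow> R \<subseteq> S \<Longrightarrow> step_rules S s t"
  by (induction rule: step_rules.induct) (auto intro: step_rules.intros)

text \<open>Well-founded induction takes each element of \<open>C\<close> to one of \<open>N\<close>
  with the same value. Two reducts of one element share its value, so injectivity of
  \<open>v\<close> on \<open>N\<close> makes the elements of \<open>N\<close> reached from them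
  equal.\<close>

lemma confluentp_if_invariant:
  assumes wf: "wfP r\<inverse>\<inverse>"
    and closed: "\<And>s t. r s t \<Longrightarrow> s \<in> C \<and> t \<in> C"
    and inv: "\<And>s t. r s t \<Longrightarrow> v s = v t"
    and progress: "\<And>s. s \<in> C \<Longrightarrow> s \<in> N \<or> (\<exists>t. r s t)"
    and inj: "inj_on v N"
  shows "confluentp r"
proof (rule confluentpI)
  have normalize: "\<exists>u\<in>N. r\<^sup>*\<^sup>* s u \<and> v u = v s" if "s \<in> C" for s
    using wf that
  proof (induction s rule: wfp_induct_rule)
    case (less s)
    then consider "s \<in> N" | t where "r s t"
      using progress by blast
    then show ?case
    proof cases
      case 2
      then show ?thesis
        using less.IH[of t] closed inv by (metis conversepI converse_rtranclp_into_rtranclp)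
    qed auto
  qed
  have inv_star: "t \<in> C \<and> v t = v s" if "r\<^sup>*\<^sup>* s t" "s \<in> C" for s t
    using that by (induction rule: rtranclp_induct) (use closed inv in force)+
  fix s t u
  assume st: "r\<^sup>*\<^sup>* s t" and su: "r\<^sup>*\<^sup>* s u"
  show "\<exists>w. r\<^sup>*\<^sup>* t w \<and> r\<^sup>*\<^sup>* u w"
  proof (cases "s \<in> C")
    case True
    then have "t \<in> C" "u \<in> C" "v t = v u"
      using inv_star st su by auto
    then obtain t' u' where "t' \<in> N" "r\<^sup>*\<^sup>* t t'" "u' \<in> N" "r\<^sup>*\<^sup>* u u'" "v t' = v u'"
      using normalize by metis
    then show ?thesis
      using inj by (metis inj_onD)
  next
    case False
    \<comment> \<open>No step leaves an element outside \<open>C\<close>, so the reduction to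
      \<open>t\<close> is empty.\<close>
    then have "t = s"
      using st closed by (metis converse_rtranclpE)
    then show ?thesis
      using su by blast
  qed
qed

section \<open>Termination by a weight in the natural numbers\<close>

text \<open>The factor 3 pays for the two minus signs in the rule for \<open>x + (-y)\<close>; the
  base 4 = 1 + 3 pays for the sum in the rule for \<open>x * app(y)\<close>. The last clause also
  covers ill-formed argument lists, since \<open>step_rules\<close> closes under contexts of any
  arity.\<close>

fun weight_op :: "symbol \<Rightarrow> nat list \<Rightarrow> nat" where
  "weight_op Plus_sym [m, n] = m + 3 * n"
| "weight_op Times_sym [m, n] = (m + 1) * 4 ^ n"
| "weight_op f ns = Suc (sum_list ns)"

lemma weight_op_strict_mono:
  assumes "m < n"
  shows "weight_op f (as @ m # bs) < weight_op f (as @ n # bs)"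
proof -
  \<comment> \<open>Only lists of length 2 can escape the default clause, and in them either
    argument may be the one that grows.\<close>
  consider b where "as = []" "bs = [b]" | a where "as = [a]" "bs = []"
    | "length (as @ m # bs) \<noteq> 2"
    by (cases as; cases bs; auto)
  then show ?thesis
  proof cases
    case 1
    then show ?thesis
      using assms by (cases f) simp_all
  next
    case 2
    have "(a + 1) * 4 ^ m < (a + 1) * 4 ^ n"
      using assms by (intro mult_strict_left_mono) simp_all
    then show ?thesis
      using assms 2 by (cases f) simp_all
  next
    case 3
    have "weight_op f ns = Suc (sum_list ns)" if "length ns \<noteq> 2" for ns
      using that by (cases "(f, ns)" rule: weight_op.cases) auto
    then show ?thesis
      using assms 3 by simp
  qed
qed

lemma rules_Z1_weight_less:
  assumes "(l, r) \<in> rules Z1"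
  shows "eval_trm weight_op \<alpha> r < eval_trm weight_op \<alpha> l"
proof -
  \<comment> \<open>The two product rules leave nonlinear inequalities: this one is
    \<open>x < (x + 1) * 4 ^ y\<close>, for the rule that unfolds \<open>x * app(y)\<close>; the
    next is for the rule that pulls a minus out of a product.\<close>
  have "\<alpha> 0 * 1 + 0 < \<alpha> 0 * 4 ^ \<alpha> 1 + 4 ^ \<alpha> 1"
    by (intro add_le_less_mono mult_le_mono2) auto
  moreover have "1 < 3 * (\<alpha> 0 * 4 ^ \<alpha> 1) + 3 * 4 ^ \<alpha> 1"
    using one_le_power[of "4 :: nat" "\<alpha> 1"] by linarith
  ultimately show ?thesis
    using assms unfolding Z1_def N1_def by auto
qed

section \<open>Integer values and the criterion for ground completeness\<close>

text \<open>The default clause supplies the value of the constant \<open>Zero_sym\<close>.\<close>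

fun int_op :: "symbol \<Rightarrow> int list \<Rightarrow> int" where
  "int_op Minus_sym [a] = - a"
| "int_op App_sym [a] = a + 1"
| "int_op Plus_sym [a, b] = a + b"
| "int_op Times_sym [a, b] = a * b"
| "int_op f as = 0"

abbreviation int_value :: "uterm \<Rightarrow> int" where
  "int_value \<equiv> eval_trm int_op (\<lambda>_. 0)"

lemma rules_Z1_int_eq:
  assumes "(l, r) \<in> rules Z1"
  shows "eval_trm int_op \<alpha> l = eval_trm int_op \<alpha> r"
  using assms unfolding Z1_def N1_def by (auto simp: algebra_simps)

lemma rules_N1_subset_Z1: "rules N1 \<subseteq> rules Z1"
  by (auto simp: Z1_def)

abbreviation closed_step :: "('f, 'v) trs \<Rightarrow> ('f, 'v) trm \<Rightarrow> ('f, 'v) trm \<Rightarrow> bool" where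
  "closed_step T s t \<equiv>
    s \<in> closed_terms (sig T) \<and> t \<in> closed_terms (sig T) \<and> rewrite_step T s t"

text \<open>Both systems have their rules among those of \<open>Z1\<close>, so one weight and one
  integer value serve both; what remains for each is progress towards a set on which the value is
  injective.\<close>

lemma ground_complete_if_progress:
  fixes T :: "(symbol, nat) trs"
  assumes sub: "rules T \<subseteq> rules Z1"
    and progress: "\<And>s. s \<in> closed_terms (sig T) \<Longrightarrow> s \<in> N \<or> (\<exists>t. closed_step T s t)"
    and inj: "inj_on int_value N"
  shows "ground_complete T"
proof -
  have step: "step_rules (rules Z1) s t" if "rewrite_step T s t" for s t
    using that sub step_rules_mono unfolding rewrite_step_def by blast
  have less: "eval_trm weight_op (\<lambda>_. 0) t < eval_trm weight_op (\<lambda>_. 0) s"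
    if "rewrite_step T s t" for s t
    using step_rules_eval_less[OF step[OF that]] rules_Z1_weight_less weight_op_strict_mono
    by blast
  have wf: "wfP (rewrite_step T)\<inverse>\<inverse>"
    by (rule wfp_if_convertible_to_nat) (use less in auto)
  have "strongly_terminating T"
    using wf unfolding strongly_terminating_def wfp_def wf_iff_no_infinite_down_chain by simp
  moreover have "confluentp (closed_step T)"
  proof (rule confluentp_if_invariant[OF _ _ _ progress inj])
    show "wfP (closed_step T)\<inverse>\<inverse>"
      by (rule wfp_subset[OF wf]) auto
    show "int_value s = int_value t" if "closed_step T s t" for s t
      using that step step_rules_eval_eq rules_Z1_int_eq by blast
  qed auto
  ultimately show ?thesis
    unfolding ground_complete_def ground_confluent_def by simp
qed

section \<open>Steps between closed terms\<close>

lemma closed_terms_Fun_iff: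
  "Fun f ts \<in> closed_terms F \<longleftrightarrow> (f, length ts) \<in> F \<and> set ts \<subseteq> closed_terms F"
  by (auto simp: closed_terms_def)

lemma closed_step_arg:
  assumes "closed_step T s t" "s \<in> set ts" "Fun f ts \<in> closed_terms (sig T)"
  shows "\<exists>u. closed_step T (Fun f ts) u"
proof -
  obtain as bs where ts: "ts = as @ s # bs"
    using assms(2) by (meson split_list)
  have "closed_step T (Fun f ts) (Fun f (as @ t # bs))"
    using assms by (auto simp: ts closed_terms_def rewrite_step_def intro: step_rules.arg)
  then show ?thesis ..
qed

lemma closed_step_root:
  assumes "(l, r) \<in> rules T" "s = subst_trm \<sigma> l" "t = subst_trm \<sigma> r"
    and "s \<in> closed_terms (sig T)" "t \<in> closed_terms (sig T)"
  shows "closed_step T s t"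
  using assms by (auto simp: closed_terms_def rewrite_step_def intro: step_rules.root)

section \<open>Canonical terms and progress\<close>

fun numeral_trm :: "nat \<Rightarrow> uterm" where
  "numeral_trm 0 = \<zero>"
| "numeral_trm (Suc n) = app (numeral_trm n)"

lemma int_value_numeral_trm [simp]: "int_value (numeral_trm n) = int n"
  by (induction n) auto

text \<open>\<open>Suc n\<close> excludes \<open>-0\<close>, which is reducible and would share the
  value of \<open>0\<close>. The values are thus \<open>n\<close> and \<open>-(n + 1)\<close>, each
  integer exactly once.\<close>

definition canonical_trms :: "uterm set" where
  "canonical_trms = range numeral_trm \<union> range (\<lambda>n. \<ominus> (numeral_trm (Suc n)))"

lemma inj_on_int_value_canonical: "inj_on int_value canonical_trms"
  by (rule inj_onI) (auto simp: canonical_trms_def)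

text \<open>For \<open>N1\<close> the claims about minus hold vacuously: such terms are not over its
  signature. This lets both systems be treated together.\<close>

lemma closed_step_if_rules:
  assumes T: "T = N1 \<or> T = Z1"
  shows "a \<oplus> \<zero> \<in> closed_terms (sig T) \<Longrightarrow> closed_step T (a \<oplus> \<zero>) a"
    and "a \<oplus> app b \<in> closed_terms (sig T) \<Longrightarrow> closed_step T (a \<oplus> app b) (app a \<oplus> b)"
    and "a \<odot> \<zero> \<in> closed_terms (sig T) \<Longrightarrow> closed_step T (a \<odot> \<zero>) \<zero>"
    and "a \<odot> app b \<in> closed_terms (sig T) \<Longrightarrow> closed_step T (a \<odot> app b) (a \<oplus> (a \<odot> b))"
    and "\<ominus> \<zero> \<in> closed_terms (sig T) \<Longrightarrow> closed_step T (\<ominus> \<zero>) \<zero>"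
    and "app (\<ominus> (app a)) \<in> closed_terms (sig T) \<Longrightarrow> closed_step T (app (\<ominus> (app a))) (\<ominus> a)"
    and "\<ominus> (\<ominus> a) \<in> closed_terms (sig T) \<Longrightarrow> closed_step T (\<ominus> (\<ominus> a)) a"
    and "a \<oplus> (\<ominus> b) \<in> closed_terms (sig T) \<Longrightarrow>
      closed_step T (a \<oplus> (\<ominus> b)) (\<ominus> ((\<ominus> a) \<oplus> b))"
    and "a \<odot> (\<ominus> b) \<in> closed_terms (sig T) \<Longrightarrow> closed_step T (a \<odot> (\<ominus> b)) (\<ominus> (a \<odot> b))"
proof -
  \<comment> \<open>The substitution sends variable 0, that is \<open>x\<close>, to \<open>a\<close>
    and variable 1, that is \<open>y\<close>, to \<open>b\<close>.\<close>
  have rule: "closed_step T s t"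
    if "(l, r) \<in> rules T"
      "s = subst_trm (case_nat a (\<lambda>_. b)) l" "t = subst_trm (case_nat a (\<lambda>_. b)) r"
      "s \<in> closed_terms (sig T)" "t \<in> closed_terms (sig T)" for l r s t
    using closed_step_root that by blast
  note facts = N1_def Z1_def closed_terms_Fun_iff Sigma_U_def
  show "a \<oplus> \<zero> \<in> closed_terms (sig T) \<Longrightarrow> closed_step T (a \<oplus> \<zero>) a"
    by (rule rule[of "x_var \<oplus> \<zero>" "x_var"]) (use T in \<open>auto simp: facts\<close>)
  show "a \<oplus> app b \<in> closed_terms (sig T) \<Longrightarrow> closed_step T (a \<oplus> app b) (app a \<oplus> b)"
    by (rule rule[of "x_var \<oplus> app y_var" "app x_var \<oplus> y_var"]) (use T in \<open>auto simp: facts\<close>)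
  show "a \<odot> \<zero> \<in> closed_terms (sig T) \<Longrightarrow> closed_step T (a \<odot> \<zero>) \<zero>"
    by (rule rule[of "x_var \<odot> \<zero>" "\<zero>"]) (use T in \<open>auto simp: facts\<close>)
  show "a \<odot> app b \<in> closed_terms (sig T) \<Longrightarrow> closed_step T (a \<odot> app b) (a \<oplus> (a \<odot> b))"
    by (rule rule[of "x_var \<odot> app y_var" "x_var \<oplus> (x_var \<odot> y_var)"])
      (use T in \<open>auto simp: facts\<close>)
  show "\<ominus> \<zero> \<in> closed_terms (sig T) \<Longrightarrow> closed_step T (\<ominus> \<zero>) \<zero>"
    by (rule rule[of "\<ominus> \<zero>" "\<zero>"]) (use T in \<open>auto simp: facts\<close>)
  show "app (\<ominus> (app a)) \<in> closed_terms (sig T) \<Longrightarrow> closed_step T (app (\<ominus> (app a))) (\<ominus> a)"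
    by (rule rule[of "app (\<ominus> (app x_var))" "\<ominus> x_var"]) (use T in \<open>auto simp: facts\<close>)
  show "\<ominus> (\<ominus> a) \<in> closed_terms (sig T) \<Longrightarrow> closed_step T (\<ominus> (\<ominus> a)) a"
    by (rule rule[of "\<ominus> (\<ominus> x_var)" "x_var"]) (use T in \<open>auto simp: facts\<close>)
  show "a \<oplus> (\<ominus> b) \<in> closed_terms (sig T) \<Longrightarrow>
      closed_step T (a \<oplus> (\<ominus> b)) (\<ominus> ((\<ominus> a) \<oplus> b))"
    by (rule rule[of "x_var \<oplus> (\<ominus> y_var)" "\<ominus> ((\<ominus> x_var) \<oplus> y_var)"])
      (use T in \<open>auto simp: facts\<close>)
  show "a \<odot> (\<ominus> b) \<in> closed_terms (sig T) \<Longrightarrow> closed_step T (a \<odot> (\<ominus> b)) (\<ominus> (a \<odot> b))"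
    by (rule rule[of "x_var \<odot> (\<ominus> y_var)" "\<ominus> (x_var \<odot> y_var)"])
      (use T in \<open>auto simp: facts\<close>)
qed

text \<open>Exposes the outer symbols on which the left-hand sides of the rules match.\<close>

lemma canonical_trms_cases:
  assumes "s \<in> canonical_trms"
  obtains (zero) "s = \<zero>" | (app) n where "s = app (numeral_trm n)"
    | (minus) n where "s = \<ominus> (app (numeral_trm n))"
proof -
  obtain n where "s = numeral_trm n \<or> s = \<ominus> (app (numeral_trm n))"
    using assms by (auto simp: canonical_trms_def)
  then show thesis
    using that by (metis numeral_trm.elims)
qed

lemma canonical_trms_intros:
  "\<zero> \<in> canonical_trms" "app (numeral_trm n) \<in> canonical_trms"
  "\<ominus> (app (numeral_trm n)) \<in> canonical_trms"
  unfolding canonical_trms_def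
  by (auto intro: range_eqI[of _ _ 0] range_eqI[of _ _ "Suc n"])

lemma closed_terms_cases:
  assumes "s \<in> closed_terms (sig T)" and T: "T = N1 \<or> T = Z1"
  obtains (zero) "s = \<zero>" | (minus) a where "s = \<ominus> a" | (app) a where "s = app a"
    | (plus) a b where "s = a \<oplus> b" | (times) a b where "s = a \<odot> b"
proof (cases s)
  case (Var x)
  then show thesis
    using assms(1) by (simp add: closed_terms_def)
next
  case (Fun f ts)
  then have "(f, length ts) \<in> Sigma_U"
    using assms by (auto simp: closed_terms_Fun_iff N1_def Z1_def)
  then show thesis
    using Fun that by (auto simp: Sigma_U_def length_Suc_conv numeral_2_eq_2)
qed

text \<open>If no argument can step, all are canonical by induction. A sum or product then always
  matches a rule, since the rules inspect only the second argument and cover its three shapes; under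
  minus or \<open>app\<close> the term is canonical or matches a rule.\<close>

lemma canonical_or_closed_step:
  assumes T: "T = N1 \<or> T = Z1" and "s \<in> closed_terms (sig T)"
  shows "s \<in> canonical_trms \<or> (\<exists>t. closed_step T s t)"
  using assms(2)
proof (induction s)
  case (Var x)
  then show ?case
    by (simp add: closed_terms_def)
next
  case (Fun f ts)
  note rules = closed_step_if_rules[OF T]
  note intros = canonical_trms_intros
  show ?case
  proof (cases "\<exists>a\<in>set ts. \<exists>t. closed_step T a t")
    case True
    then show ?thesis
      using closed_step_arg[OF _ _ Fun.prems] by metis
  next
    case False
    then have args: "a \<in> canonical_trms" if "a \<in> set ts" for a
      using Fun.IH[OF that] Fun.prems that by (auto simp: closed_terms_Fun_iff)
    from Fun.prems T show ?thesis
    proof (cases rule: closed_terms_cases)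
      case zero
      then show ?thesis
        using intros(1) by simp
    next
      case eq: (minus a)
      then have arg: "a \<in> canonical_trms"
        using args by simp
      from arg show ?thesis
      proof (cases rule: canonical_trms_cases)
        case zero
        show ?thesis
          using rules(5)[OF Fun.prems[unfolded eq zero]]
          unfolding eq zero by (rule exI[THEN disjI2])
      next
        case (app n)
        show ?thesis
          using intros(3) eq app by simp
      next
        case (minus n)
        show ?thesis
          using rules(7)[OF Fun.prems[unfolded eq minus]]
          unfolding eq minus by (rule exI[THEN disjI2])
      qed
    next
      case eq: (app a)
      then have arg: "a \<in> canonical_trms"
        using args by simp
      from arg show ?thesis
      proof (cases rule: canonical_trms_cases)
        case zero
        show ?thesis
          using intros(2)[of 0] eq zero by simp
      next
        case (app n)
        show ?thesis
          using intros(2)[of "Suc n"] eq app by simp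
      next
        \<comment> \<open>The rule for \<open>app\<close> of a minus needs a further
          \<open>app\<close> below the minus, which a negative canonical term always has.\<close>
        case (minus n)
        show ?thesis
          using rules(6)[OF Fun.prems[unfolded eq minus]]
          unfolding eq minus by (rule exI[THEN disjI2])
      qed
    next
      case eq: (plus a b)
      then have arg: "b \<in> canonical_trms"
        using args by simp
      from arg show ?thesis
      proof (cases rule: canonical_trms_cases)
        case zero
        show ?thesis
          using rules(1)[OF Fun.prems[unfolded eq zero]]
          unfolding eq zero by (rule exI[THEN disjI2])
      next
        case (app n)
        show ?thesis
          using rules(2)[OF Fun.prems[unfolded eq app]]
          unfolding eq app by (rule exI[THEN disjI2])
      next
        case (minus n)
        show ?thesis
          using rules(8)[OF Fun.prems[unfolded eq minus]]
          unfolding eq minus by (rule exI[THEN disjI2])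
      qed
    next
      case eq: (times a b)
      then have arg: "b \<in> canonical_trms"
        using args by simp
      from arg show ?thesis
      proof (cases rule: canonical_trms_cases)
        case zero
        show ?thesis
          using rules(3)[OF Fun.prems[unfolded eq zero]]
          unfolding eq zero by (rule exI[THEN disjI2])
      next
        case (app n)
        show ?thesis
          using rules(4)[OF Fun.prems[unfolded eq app]]
          unfolding eq app by (rule exI[THEN disjI2])
      next
        case (minus n)
        show ?thesis
          using rules(9)[OF Fun.prems[unfolded eq minus]]
          unfolding eq minus by (rule exI[THEN disjI2])
      qed
    qed
  qed
qed

theorem theorem3p1p2:
  shows "ground_complete N1 \<and> ground_complete Z1"
  using ground_complete_if_progress[OF _ canonical_or_closed_step inj_on_int_value_canonical]
    rules_N1_subset_Z1
  by blast

end
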